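(* Let $X$ be a real Hilbert space and let $R\colon X\to X$ be a linear nonexpansive mapping. Let $(\lambda_n)_{n\in\mathbb{N}}$ be a sequence of real numbers, and suppose that there exists $\varepsilon>0$ such that $\varepsilon\le\lambda_n\le 1-\varepsilon$ for all $n\in\mathbb{N}$. Let $x_0\in X$ and generate the sequence $(x_n)_{n\in\mathbb{N}}$ by $x_{n+1}:=T_{\lambda_n}x_n$ for all $n\in\mathbb{N}$. Then $(x_n)_{n\in\mathbb{N}}$ converges strongly (in norm) to $P_{\operatorname{Fix}R}x_0$.
   Context: Nonexpansive means $\|Rx-Ry\|\le\|x-y\|$ for all $x,y\in X$. $\operatorname{Fix}R=\{x\in X : Rx=x\}$, which for linear nonexpansive $R$ is a (nonempty) closed linear subspace; $P_{\operatorname{Fix}R}$ denotes the orthogonal projection onto it. For $\lambda\in\mathbb{R}$, $T_\lambda:=(1-\lambda)\operatorname{Id}+\lambda R$. Here $\mathbb{N}=\{0,1,2,\ldots\}$. *)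

theory Defs
  imports "HOL-Analysis.Analysis"
begin

definition nonexpansive :: "('a::real_normed_vector \<Rightarrow> 'a) \<Rightarrow> bool" where
  "nonexpansive R \<longleftrightarrow> (\<forall>x y. norm (R x - R y) \<le> norm (x - y))"

definition Fix :: "('a \<Rightarrow> 'a) \<Rightarrow> 'a set" where
  "Fix R = {x. R x = x}"

definition relaxation :: "('a::real_vector \<Rightarrow> 'a) \<Rightarrow> real \<Rightarrow> 'a \<Rightarrow> 'a" where
  "relaxation R l x = (1 - l) *\<^sub>R x + l *\<^sub>R R x"

text \<open>The orthogonal projection is meaningful when \<open>S\<close> is a closed linear subspace of a
  Hilbert space: then exactly one \<open>p\<close> has the defining property. The library's
  \<open>closest_point\<close> is restricted to \<open>heine_borel\<close> spaces, that is to finite dimension.\<close>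

definition orthogonal_projection :: "'a::real_inner set \<Rightarrow> 'a \<Rightarrow> 'a" where
  "orthogonal_projection S x = (THE p. p \<in> S \<and> (\<forall>y\<in>S. orthogonal (x - p) y))"

end

theory Submission
  imports Defs
begin

text \<open>Every iterate is \<open>x n = T n x0\<close> for a linear contraction \<open>T n\<close> commuting with \<open>R\<close>.
  The identity
  \<open>\<parallel>(1 - l) y + l R y\<parallel>\<^sup>2 = (1 - l) \<parallel>y\<parallel>\<^sup>2 + l \<parallel>R y\<parallel>\<^sup>2 - l (1 - l) \<parallel>y - R y\<parallel>\<^sup>2\<close>
  makes \<open>\<parallel>T n y - R (T n y)\<parallel>\<^sup>2\<close> summable, so \<open>T n\<close> tends to \<open>0\<close> pointwise on the range of
  \<open>Id - R\<close> and, by uniform boundedness, on its closure. Let \<open>p\<close> be the element of least norm of the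
  closure of \<open>x0 + range (Id - R)\<close>. That set is invariant under \<open>R\<close>, and \<open>R\<close> does not increase norms,
  so uniqueness of \<open>p\<close> gives \<open>R p = p\<close>. Hence \<open>T n x0 = p + T n (x0 - p)\<close> tends to \<open>p\<close>. Finally
  \<open>range (Id - R)\<close> is orthogonal to \<open>Fix R\<close>, so \<open>p\<close> is the projection of \<open>x0\<close>.\<close>

section \<open>Elements of least norm in closed convex sets\<close>

lemma norm_diff_sq_le_of_midpoint:
  fixes a b :: "'a::real_inner"
  assumes "d \<le> (norm ((1/2) *\<^sub>R a + (1/2) *\<^sub>R b))\<^sup>2"
  shows "(norm (a - b))\<^sup>2 \<le> 2 * (norm a)\<^sup>2 + 2 * (norm b)\<^sup>2 - 4 * d"
  using assms by (simp add: power2_norm_eq_inner algebra_simps inner_commute)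

text \<open>A sequence in \<open>S\<close> minimizing the norm is Cauchy, and its limit is
  \<open>p\<close>. The second property of \<open>p\<close> expresses minimality and uniqueness at
  once, the form in which \<open>R p = p\<close> is later obtained.\<close>

lemma closed_convex_min_norm:
  fixes S :: "'a::{real_inner, complete_space} set"
  assumes "closed S" "convex S" "S \<noteq> {}"
  obtains p where "p \<in> S" "\<And>y. y \<in> S \<Longrightarrow> norm y \<le> norm p \<Longrightarrow> y = p"
proof -
  define d where "d = (INF y\<in>S. (norm y)\<^sup>2)"
  have bdd: "bdd_below ((\<lambda>y. (norm y)\<^sup>2) ` S)"
    by (intro bdd_belowI[of _ 0]) auto
  have d_le: "d \<le> (norm y)\<^sup>2" if "y \<in> S" for y
    unfolding d_def using bdd that by (intro cINF_lower) auto
  have "\<exists>c\<in>S. (norm c)\<^sup>2 < d + inverse (real (Suc n))" for n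
    using cINF_less_iff[OF assms(3) bdd, of "d + inverse (real (Suc n))"]
    by (simp add: d_def)
  then obtain c where c: "\<And>n. c n \<in> S" "\<And>n. (norm (c n))\<^sup>2 < d + inverse (real (Suc n))"
    by metis
  \<comment> \<open>Convexity puts the midpoint of \<open>a\<close> and \<open>b\<close> into
    \<open>S\<close>, so its squared norm is at least the infimum \<open>d\<close>; the rest is the
    parallelogram law.\<close>
  have gap: "(norm (a - b))\<^sup>2 \<le> 2 * (norm a)\<^sup>2 + 2 * (norm b)\<^sup>2 - 4 * d" if "a \<in> S" "b \<in> S" for a b
    using that assms(2) by (intro norm_diff_sq_le_of_midpoint d_le convexD) auto
  have "Cauchy c"
  proof (rule metric_CauchyI)
    fix e :: real assume "e > 0"
    \<comment> \<open>By \<open>gap\<close>, the squared distance of \<open>c m\<close> and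
      \<open>c n\<close> is below twice the sum of two excesses over \<open>d\<close>, each at most
      \<open>inverse (real (Suc N))\<close>; hence the factor 4.\<close>
    then obtain N where N: "inverse (real (Suc N)) < e\<^sup>2 / 4"
      using reals_Archimedean[of "e\<^sup>2 / 4"] by auto
    show "\<exists>M. \<forall>m\<ge>M. \<forall>n\<ge>M. dist (c m) (c n) < e"
    proof (intro exI[of _ N] allI impI)
      fix m n assume "m \<ge> N" "n \<ge> N"
      then have "inverse (real (Suc m)) \<le> inverse (real (Suc N))"
        "inverse (real (Suc n)) \<le> inverse (real (Suc N))"
        by (auto intro!: le_imp_inverse_le)
      then have "(norm (c m - c n))\<^sup>2 < e\<^sup>2"
        using gap[OF c(1) c(1), of m n] c(2)[of m] c(2)[of n] N by linarith
      then show "dist (c m) (c n) < e"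
        using \<open>e > 0\<close> by (simp add: dist_norm power_less_imp_less_base)
    qed
  qed
  then obtain p where p: "c \<longlonglongrightarrow> p"
    using Cauchy_convergent_iff convergent_def by blast
  have pS: "p \<in> S"
    using closed_sequentially[OF assms(1)] c(1) p by blast
  have "(norm p)\<^sup>2 \<le> d + 0"
  proof (rule LIMSEQ_le)
    show "(\<lambda>n. (norm (c n))\<^sup>2) \<longlonglongrightarrow> (norm p)\<^sup>2"
      by (intro tendsto_intros p)
    show "(\<lambda>n. d + inverse (real (Suc n))) \<longlonglongrightarrow> d + 0"
      by (intro tendsto_intros LIMSEQ_inverse_real_of_nat)
    show "\<exists>N. \<forall>n\<ge>N. (norm (c n))\<^sup>2 \<le> d + inverse (real (Suc n))"
      using c(2) less_imp_le by blast
  qed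
  then have pd: "(norm p)\<^sup>2 \<le> d" by simp
  have "y = p" if "y \<in> S" "norm y \<le> norm p" for y
  proof -
    have "(norm y)\<^sup>2 \<le> d"
      using power_mono[OF that(2) norm_ge_zero, of 2] pd by linarith
    then have "(norm (y - p))\<^sup>2 \<le> 0"
      using gap[OF that(1) pS] pd by linarith
    then show ?thesis by simp
  qed
  then show thesis using that pS by blast
qed

lemma subspace_closure:
  fixes S :: "'a::real_normed_vector set"
  assumes "subspace S"
  shows "subspace (closure S)"
  unfolding subspace_def
proof (intro conjI ballI allI)
  show "0 \<in> closure S"
    using subspace_0[OF assms] closure_subset by blast
next
  fix x y assume "x \<in> closure S" "y \<in> closure S"
  then obtain a b where "\<And>n. a n \<in> S" "a \<longlonglongrightarrow> x" "\<And>n. b n \<in> S" "b \<longlonglongrightarrow> y"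
    unfolding closure_sequential by blast
  then have "\<And>n. a n + b n \<in> S" "(\<lambda>n. a n + b n) \<longlonglongrightarrow> x + y"
    by (auto intro: subspace_add[OF assms] tendsto_add)
  then show "x + y \<in> closure S"
    unfolding closure_sequential by (intro exI[of _ "\<lambda>n. a n + b n"]) auto
next
  fix c :: real and x assume "x \<in> closure S"
  then obtain a where "\<And>n. a n \<in> S" "a \<longlonglongrightarrow> x"
    unfolding closure_sequential by blast
  then have "\<And>n. c *\<^sub>R a n \<in> S" "(\<lambda>n. c *\<^sub>R a n) \<longlonglongrightarrow> c *\<^sub>R x"
    by (auto intro: subspace_scale[OF assms] tendsto_scaleR)
  then show "c *\<^sub>R x \<in> closure S"
    unfolding closure_sequential by (intro exI[of _ "\<lambda>n. c *\<^sub>R a n"]) auto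
qed

section \<open>Linear nonexpansive maps and orthogonality to their fixed points\<close>

lemma nonexpansive_linear_norm_le:
  assumes "linear R" "nonexpansive R"
  shows "norm (R y) \<le> norm y"
  using assms(2)[unfolded nonexpansive_def, rule_format, of y 0] linear_0[OF assms(1)] by simp

text \<open>A perturbation argument: comparing the norms of \<open>R (f + t *\<^sub>R y)\<close> and
  \<open>f + t *\<^sub>R y\<close> for every real \<open>t\<close> bounds a linear term in
  \<open>t\<close> by a quadratic one, so the linear coefficient vanishes.\<close>

lemma inner_residual_Fix_eq_0:
  fixes R :: "'a::real_inner \<Rightarrow> 'a"
  assumes "linear R" "nonexpansive R" "f \<in> Fix R"
  shows "(y - R y) \<bullet> f = 0"
proof -
  define a where "a = 2 * ((R y - y) \<bullet> f)"
  have quad: "t * a \<le> t\<^sup>2 * (norm y)\<^sup>2" for t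
  proof -
    have "R (f + t *\<^sub>R y) = f + t *\<^sub>R R y"
      using assms by (simp add: linear_add linear_scale Fix_def)
    then have "(norm (f + t *\<^sub>R R y))\<^sup>2 \<le> (norm (f + t *\<^sub>R y))\<^sup>2"
      using nonexpansive_linear_norm_le[OF assms(1,2), of "f + t *\<^sub>R y"] by (simp add: power_mono)
    moreover have "(norm (f + t *\<^sub>R w))\<^sup>2 = (norm f)\<^sup>2 + 2 * t * (w \<bullet> f) + t\<^sup>2 * (norm w)\<^sup>2" for w
      unfolding power2_norm_eq_inner by (simp add: algebra_simps inner_commute power2_eq_square)
    moreover have "0 \<le> t\<^sup>2 * (norm (R y))\<^sup>2" by simp
    ultimately have "2 * t * (R y \<bullet> f) \<le> 2 * t * (y \<bullet> f) + t\<^sup>2 * (norm y)\<^sup>2" by smt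
    then show ?thesis by (simp add: a_def inner_diff_left algebra_simps)
  qed
  have "a = 0"
  proof (rule ccontr)
    assume "a \<noteq> 0"
    \<comment> \<open>Testing \<open>quad\<close> at \<open>t = a / s\<close> yields
      \<open>a\<^sup>2 * s \<le> a\<^sup>2 * (norm y)\<^sup>2\<close>; the added 1 makes
      \<open>s\<close> positive and strictly larger than \<open>(norm y)\<^sup>2\<close>.\<close>
    define s where "s = (norm y)\<^sup>2 + 1"
    have s: "s > 0" "(norm y)\<^sup>2 < s" unfolding s_def by (auto simp: add_pos_nonneg add_nonneg_pos)
    have "(a / s) * a * s\<^sup>2 \<le> (a / s)\<^sup>2 * (norm y)\<^sup>2 * s\<^sup>2"
      by (rule mult_right_mono[OF quad]) simp
    then have "a\<^sup>2 * s \<le> a\<^sup>2 * (norm y)\<^sup>2"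
      using s by (simp add: power2_eq_square field_simps)
    then show False using s \<open>a \<noteq> 0\<close> by simp
  qed
  then show ?thesis by (simp add: a_def inner_diff_left)
qed

text \<open>Two candidates differ by an element of \<open>S\<close> orthogonal to both residuals,
  hence to itself; this settles the uniqueness demanded by the definite description.\<close>

lemma orthogonal_projectionI:
  assumes "subspace S" "p \<in> S" "\<And>y. y \<in> S \<Longrightarrow> orthogonal (x - p) y"
  shows "orthogonal_projection S x = p"
  unfolding orthogonal_projection_def
proof (rule the_equality)
  fix q assume q: "q \<in> S \<and> (\<forall>y\<in>S. orthogonal (x - q) y)"
  then have "q - p \<in> S" using assms(1,2) subspace_diff by blast
  then have "orthogonal (x - p) (q - p)" "orthogonal (x - q) (q - p)"
    using assms(3) q by auto
  then have "(q - p) \<bullet> (q - p) = 0"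
    by (simp add: orthogonal_def algebra_simps inner_commute)
  then show "q = p" by simp
qed (use assms in auto)

lemma subspace_Fix: "linear R \<Longrightarrow> subspace (Fix R)"
  by (simp add: subspace_def Fix_def linear_0 linear_add linear_scale)

section \<open>Relaxations and their iterates\<close>

lemma norm_relaxation_sq:
  fixes R :: "'a::real_inner \<Rightarrow> 'a"
  shows "(norm (relaxation R l y))\<^sup>2 =
    (1 - l) * (norm y)\<^sup>2 + l * (norm (R y))\<^sup>2 - l * (1 - l) * (norm (y - R y))\<^sup>2"
  unfolding relaxation_def power2_norm_eq_inner
  by (simp add: algebra_simps inner_commute)

lemma linear_relaxation: "linear R \<Longrightarrow> linear (relaxation R l)"
  by (intro linearI) (simp_all add: relaxation_def linear_add linear_scale algebra_simps)

lemma relaxation_commute: "linear R \<Longrightarrow> R (relaxation R l y) = relaxation R l (R y)"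
  by (simp add: relaxation_def linear_add linear_scale)

text \<open>Serves twice: \<epsilon> = 0 shows that a relaxation does not increase norms, and
  \<epsilon> > 0 controls the residual by the loss of squared norm.\<close>

lemma norm_relaxation_sq_le:
  fixes R :: "'a::real_inner \<Rightarrow> 'a"
  assumes "linear R" "nonexpansive R" "0 \<le> \<epsilon>" "\<epsilon> \<le> l" "l \<le> 1 - \<epsilon>"
  shows "\<epsilon>\<^sup>2 * (norm (y - R y))\<^sup>2 \<le> (norm y)\<^sup>2 - (norm (relaxation R l y))\<^sup>2"
proof -
  have "l * (norm (R y))\<^sup>2 \<le> l * (norm y)\<^sup>2"
    using nonexpansive_linear_norm_le[OF assms(1,2), of y] assms(3,4)
    by (intro mult_left_mono power_mono) auto
  \<comment> \<open>Both \<open>l\<close> and \<open>1 - l\<close> are at least \<epsilon>.\<close>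
  moreover have "\<epsilon> * \<epsilon> \<le> l * (1 - l)"
    using assms(3-5) by (intro mult_mono) auto
  then have "\<epsilon>\<^sup>2 * (norm (y - R y))\<^sup>2 \<le> l * (1 - l) * (norm (y - R y))\<^sup>2"
    unfolding power2_eq_square[of \<epsilon>] by (intro mult_right_mono) auto
  ultimately show ?thesis by (simp add: norm_relaxation_sq algebra_simps)
qed

text \<open>The iteration as an operator on the starting point, so that linearity and commutation
  with \<open>R\<close> can be stated.\<close>

primrec relaxed_iterate :: "('a::real_vector \<Rightarrow> 'a) \<Rightarrow> (nat \<Rightarrow> real) \<Rightarrow> nat \<Rightarrow> 'a \<Rightarrow> 'a" where
  "relaxed_iterate R lam 0 y = y"
| "relaxed_iterate R lam (Suc n) y = relaxation R (lam n) (relaxed_iterate R lam n y)"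

lemma linear_relaxed_iterate:
  assumes "linear R"
  shows "linear (relaxed_iterate R lam n)"
proof (induction n)
  case 0
  then show ?case by (intro linearI) auto
next
  case (Suc n)
  then show ?case
    by (intro linearI) (simp_all add: linear_add linear_scale linear_relaxation[OF assms])
qed

lemma relaxed_iterate_commute:
  "linear R \<Longrightarrow> relaxed_iterate R lam n (R y) = R (relaxed_iterate R lam n y)"
  by (induction n) (simp_all add: relaxation_commute)

lemma relaxed_iterate_Fix: "p \<in> Fix R \<Longrightarrow> relaxed_iterate R lam n p = p"
  by (induction n) (auto simp: relaxation_def Fix_def algebra_simps)

lemma norm_relaxed_iterate_le:
  fixes R :: "'a::real_inner \<Rightarrow> 'a"
  assumes "linear R" "nonexpansive R" "\<And>n. 0 \<le> lam n" "\<And>n. lam n \<le> 1"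
  shows "norm (relaxed_iterate R lam n y) \<le> norm y"
proof (induction n)
  case (Suc n)
  have "(norm (relaxed_iterate R lam (Suc n) y))\<^sup>2 \<le> (norm (relaxed_iterate R lam n y))\<^sup>2"
    using norm_relaxation_sq_le[OF assms(1,2), of 0 "lam n" "relaxed_iterate R lam n y"] assms(3,4)
    by simp
  then show ?case using Suc by (meson norm_ge_zero order_trans power2_le_imp_le)
qed simp

text \<open>Commutation turns the iterate of \<open>y - R y\<close> into the residual of the iterate
  of \<open>y\<close>. The squared norms of the iterates of \<open>y\<close> decrease to a limit, so
  their successive differences, which dominate the squared residuals up to
  \<open>\<epsilon>\<^sup>2\<close>, vanish in the limit.\<close>

lemma relaxed_iterate_residual_tendsto_0:
  fixes R :: "'a::real_inner \<Rightarrow> 'a"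
  assumes "linear R" "nonexpansive R" "0 < \<epsilon>" "\<And>n. \<epsilon> \<le> lam n" "\<And>n. lam n \<le> 1 - \<epsilon>"
  shows "(\<lambda>n. relaxed_iterate R lam n (y - R y)) \<longlonglongrightarrow> 0"
proof -
  define u where "u n = relaxed_iterate R lam n y" for n
  have u_res: "relaxed_iterate R lam n (y - R y) = u n - R (u n)" for n
    using assms(1)
    by (simp add: u_def linear_diff[OF linear_relaxed_iterate] relaxed_iterate_commute)
  have step: "\<epsilon>\<^sup>2 * (norm (u n - R (u n)))\<^sup>2 \<le> (norm (u n))\<^sup>2 - (norm (u (Suc n)))\<^sup>2" for n
    using norm_relaxation_sq_le[OF assms(1,2) less_imp_le[OF assms(3)] assms(4,5), of "u n"]
    by (simp add: u_def)
  have "(norm (u (Suc n)))\<^sup>2 \<le> (norm (u n))\<^sup>2" for n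
  proof -
    have "0 \<le> \<epsilon>\<^sup>2 * (norm (u n - R (u n)))\<^sup>2" by simp
    then show ?thesis using step[of n] by linarith
  qed
  then have "decseq (\<lambda>n. (norm (u n))\<^sup>2)" by (rule decseq_SucI)
  then obtain L where L: "(\<lambda>n. (norm (u n))\<^sup>2) \<longlonglongrightarrow> L"
    by (rule decseq_convergent[where B = 0]) simp_all
  have "(\<lambda>n. (norm (u n))\<^sup>2 - (norm (u (Suc n)))\<^sup>2) \<longlonglongrightarrow> L - L"
    by (intro tendsto_diff L LIMSEQ_Suc)
  then have diff: "(\<lambda>n. (norm (u n))\<^sup>2 - (norm (u (Suc n)))\<^sup>2) \<longlonglongrightarrow> 0"
    by (simp only: diff_self)
  have "(\<lambda>n. \<epsilon>\<^sup>2 * (norm (u n - R (u n)))\<^sup>2) \<longlonglongrightarrow> 0"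
  proof (rule tendsto_sandwich[OF _ _ tendsto_const diff])
    show "\<forall>\<^sub>F n in sequentially. 0 \<le> \<epsilon>\<^sup>2 * (norm (u n - R (u n)))\<^sup>2"
      by simp
    show "\<forall>\<^sub>F n in sequentially.
        \<epsilon>\<^sup>2 * (norm (u n - R (u n)))\<^sup>2 \<le> (norm (u n))\<^sup>2 - (norm (u (Suc n)))\<^sup>2"
      by (rule always_eventually) (rule allI, rule step)
  qed
  then have "(\<lambda>n. (1 / \<epsilon>\<^sup>2) * (\<epsilon>\<^sup>2 * (norm (u n - R (u n)))\<^sup>2)) \<longlonglongrightarrow> (1 / \<epsilon>\<^sup>2) * 0"
    by (rule tendsto_mult_left)
  then have "(\<lambda>n. (norm (u n - R (u n)))\<^sup>2) \<longlonglongrightarrow> 0"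
    using assms(3) by simp
  then have "(\<lambda>n. sqrt ((norm (u n - R (u n)))\<^sup>2)) \<longlonglongrightarrow> sqrt 0"
    by (rule tendsto_real_sqrt)
  then show ?thesis unfolding u_res by (simp add: tendsto_norm_zero_iff)
qed

section \<open>The closed range of \<open>Id - R\<close> and the limit of the iteration\<close>

lemma contractions_tendsto_0_on_closure:
  fixes T :: "nat \<Rightarrow> 'a::real_normed_vector \<Rightarrow> 'b::real_normed_vector"
  assumes lin: "\<And>n. linear (T n)" and le: "\<And>n y. norm (T n y) \<le> norm y"
    and S: "\<And>y. y \<in> S \<Longrightarrow> (\<lambda>n. T n y) \<longlonglongrightarrow> 0" and z: "z \<in> closure S"
  shows "(\<lambda>n. T n z) \<longlonglongrightarrow> 0"
proof (rule LIMSEQ_I)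
  fix e :: real assume "e > 0"
  then obtain y where y: "y \<in> S" "dist y z < e / 2"
    using z closure_approachable[of z S] by (meson half_gt_zero)
  obtain N where N: "\<And>n. n \<ge> N \<Longrightarrow> norm (T n y) < e / 2"
    using LIMSEQ_D[OF S[OF y(1)], of "e / 2"] \<open>e > 0\<close> by auto
  have "norm (T n z) < e" if "n \<ge> N" for n
  proof -
    \<comment> \<open>The error from replacing \<open>z\<close> by \<open>y\<close> is at most
      \<open>norm (z - y)\<close>, independently of \<open>n\<close>.\<close>
    have "T n z = T n y + T n (z - y)" by (simp add: linear_diff[OF lin])
    then have "norm (T n z) \<le> norm (T n y) + norm (z - y)"
      using norm_triangle_ineq[of "T n y" "T n (z - y)"] le[of n "z - y"] by simp
    then show ?thesis using N[OF that] y(2) by (simp add: dist_norm norm_minus_commute)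
  qed
  then show "\<exists>N. \<forall>n\<ge>N. norm (T n z - 0) < e" by auto
qed

lemma Fix_closure_range_decomposition:
  fixes R :: "'a::{real_inner, complete_space} \<Rightarrow> 'a"
  assumes "linear R" "nonexpansive R"
  obtains p where "p \<in> Fix R" "x - p \<in> closure (range (\<lambda>y. y - R y))"
proof -
  define D where "D = range (\<lambda>y. y - R y)"
  \<comment> \<open>As \<open>closure D\<close> is a subspace, this is also its translate by
    \<open>x\<close>; the minus sign makes membership of \<open>p\<close> say directly that
    \<open>x - p\<close> lies in \<open>closure D\<close>.\<close>
  define C where "C = (\<lambda>w. x - w) ` closure D"
  have lin: "linear (\<lambda>y. y - R y)"
    using assms(1) by (intro linear_compose_sub linear_ident)
  have D: "subspace D" unfolding D_def by (rule linear_subspace_image[OF lin subspace_UNIV])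
  then have clD: "subspace (closure D)" by (rule subspace_closure)
  have "closed C"
    unfolding C_def using closed_translation[of "uminus ` closure D" x] closed_negations[of "closure D"]
    by (simp add: image_image)
  moreover have "convex C"
    unfolding C_def using convex_translation[of "uminus ` closure D" x]
      convex_negations[OF subspace_imp_convex[OF clD]] by (simp add: image_image)
  moreover have "C \<noteq> {}" unfolding C_def D_def by simp
  ultimately obtain p where p: "p \<in> C" "\<And>y. y \<in> C \<Longrightarrow> norm y \<le> norm p \<Longrightarrow> y = p"
    using closed_convex_min_norm by blast
  then have xp: "x - p \<in> closure D" by (auto simp: C_def)
  have "x - R p = (x - p) + (p - R p)" by simp
  moreover have "p - R p \<in> closure D" unfolding D_def
    by (rule subsetD[OF closure_subset rangeI])
  ultimately have "x - R p \<in> closure D" using xp subspace_add[OF clD] by metis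
  then have "R p \<in> C" unfolding C_def by (intro image_eqI[of _ _ "x - R p"]) auto
  then have "R p = p" using p(2) nonexpansive_linear_norm_le[OF assms] by blast
  then show thesis using that xp by (simp add: Fix_def D_def)
qed

theorem theorem1p3:
  fixes R :: "'a::{real_inner, complete_space} \<Rightarrow> 'a"
    and lam :: "nat \<Rightarrow> real"
    and x0 :: 'a
    and x :: "nat \<Rightarrow> 'a"
  assumes "linear R"
    and "nonexpansive R"
    and "\<exists>\<epsilon>>0. \<forall>n. \<epsilon> \<le> lam n \<and> lam n \<le> 1 - \<epsilon>"
    and "x 0 = x0"
    and "\<forall>n. x (Suc n) = relaxation R (lam n) (x n)"
  shows "x \<longlonglongrightarrow> orthogonal_projection (Fix R) x0"
proof -
  obtain \<epsilon> where \<epsilon>: "\<epsilon> > 0" "\<And>n. \<epsilon> \<le> lam n" "\<And>n. lam n \<le> 1 - \<epsilon>"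
    using assms(3) by blast
  have lam: "0 \<le> lam n" "lam n \<le> 1" for n
    using \<epsilon>(1) \<epsilon>(2,3)[of n] by linarith+
  obtain p where p: "p \<in> Fix R" "x0 - p \<in> closure (range (\<lambda>y. y - R y))"
    using Fix_closure_range_decomposition[OF assms(1,2)] by blast
  have "orthogonal (x0 - p) f" if "f \<in> Fix R" for f
  proof -
    \<comment> \<open>Orthogonality to \<open>f\<close> defines a closed hyperplane or the whole
      space, so it passes from the range to its closure.\<close>
    have "range (\<lambda>y. y - R y) \<subseteq> {w. f \<bullet> w = 0}"
      using inner_residual_Fix_eq_0[OF assms(1,2) that] by (auto simp: inner_commute)
    then have "closure (range (\<lambda>y. y - R y)) \<subseteq> {w. f \<bullet> w = 0}"
      by (intro closure_minimal closed_hyperplane)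
    then show ?thesis using p(2) by (auto simp: orthogonal_def inner_commute)
  qed
  then have proj: "orthogonal_projection (Fix R) x0 = p"
    using p(1) by (intro orthogonal_projectionI subspace_Fix assms(1))
  have "x n = relaxed_iterate R lam n x0" for n
    by (induction n) (simp_all add: assms(4,5))
  \<comment> \<open>Linearity splits off \<open>p\<close>, which every iterate fixes, leaving a
    vector on which the iterates tend to 0.\<close>
  then have x_eq: "x n = p + relaxed_iterate R lam n (x0 - p)" for n
    by (simp add: linear_diff[OF linear_relaxed_iterate[OF assms(1)]] relaxed_iterate_Fix[OF p(1)])
  have "(\<lambda>n. relaxed_iterate R lam n (x0 - p)) \<longlonglongrightarrow> 0"
  proof (rule contractions_tendsto_0_on_closure[OF _ _ _ p(2)])
    show "linear (relaxed_iterate R lam n)" for n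
      by (rule linear_relaxed_iterate[OF assms(1)])
    show "norm (relaxed_iterate R lam n y) \<le> norm y" for n y
      by (rule norm_relaxed_iterate_le[OF assms(1,2) lam])
    show "(\<lambda>n. relaxed_iterate R lam n y) \<longlonglongrightarrow> 0" if "y \<in> range (\<lambda>y. y - R y)" for y
      using that relaxed_iterate_residual_tendsto_0[OF assms(1,2) \<epsilon>] by auto
  qed
  then have "(\<lambda>n. p + relaxed_iterate R lam n (x0 - p)) \<longlonglongrightarrow> p + 0"
    by (intro tendsto_add tendsto_const)
  then show ?thesis by (simp add: proj x_eq[abs_def])
qed

end
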